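(* Let $n=4k+r$ with integers $k\ge0$ and $0\le r<4$, and let $t_n(1,-1)=\sum_{\pi}(-1)^{\sigma_2(\pi)}$, the sum over all involutions $\pi$ of $[n]$, where $\sigma_2(\pi)$ is the number of 2-cycles of $\pi$. Then $${\rm ord}_2(t_n(1,-1))=\begin{cases}k+\lfloor r/2\rfloor,&\text{if } r\ne2,\\ k+3+{\rm ord}_2(k),&\text{if } r=2.\end{cases}$$
   Context: ${\rm ord}_2(m)$ denotes the largest integer $e$ with $2^e\mid m$, with the convention ${\rm ord}_2(0)=+\infty$. An involution of $[n]$ is a permutation $\pi$ with $\pi^2=1$. *)

theory Defs
  imports
    "HOL-Library.Extended_Nat"
    "HOL-Computational_Algebra.Primes"
    "HOL-Combinatorics.Permutations"
    "HOL-Combinatorics.Orbits"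
begin

definition ord2 :: "int \<Rightarrow> enat" where
  "ord2 m = (if m = 0 then \<infinity> else enat (multiplicity 2 m))"

definition involutions :: "nat \<Rightarrow> (nat \<Rightarrow> nat) set" where
  "involutions n = {\<pi>. \<pi> permutes {1..n} \<and> \<pi> \<circ> \<pi> = id}"

text \<open>A cycle is identified with its support, i.e. with an orbit; this loses nothing for
  2-cycles, which are determined by their two points.\<close>
definition num_two_cycles :: "(nat \<Rightarrow> nat) \<Rightarrow> nat \<Rightarrow> nat" where
  "num_two_cycles \<pi> n = card {C. (\<exists>i\<in>{1..n}. C = orbit \<pi> i) \<and> card C = 2}"

text \<open>\<open>t_signed n\<close> is $t_n(1,-1)$.\<close>
definition t_signed :: "nat \<Rightarrow> int" where
  "t_signed n = (\<Sum>\<pi>\<in>involutions n. (- 1) ^ num_two_cycles \<pi> n)"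

end

theory Submission
  imports Defs
begin

text \<open>Sorting involutions by the image of the last point gives
  \<open>t(n + 2) = t(n + 1) - (n + 1) t(n)\<close>. Four steps of this recurrence show inductively that
  \<open>t(4k) = 2^k a\<close> and \<open>t(4k + 1) = 2^k (8kc + (4k + 1) a)\<close> with \<open>a\<close> and \<open>c\<close> odd. Hence
  \<open>t(4k + 2) = 2^(k + 3) k c\<close>, and \<open>t(4k + 3) = -2^(k + 1) (4k + 1) (4kc + (2k + 1) a)\<close>.\<close>

section \<open>Involutions and their 2-cycles on arbitrary sets\<close>

definition involutions_on :: "'a set \<Rightarrow> ('a \<Rightarrow> 'a) set" where
  "involutions_on S = {\<pi>. \<pi> permutes S \<and> \<pi> \<circ> \<pi> = id}"

text \<open>Each 2-cycle arises from both of its points but counts once, since the pairs are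
  unordered.\<close>

definition two_cycles :: "('a \<Rightarrow> 'a) \<Rightarrow> 'a set set" where
  "two_cycles \<pi> = {{i, \<pi> i} |i. \<pi> i \<noteq> i}"

text \<open>Arbitrary sets are needed because deleting a point \<open>j\<close> from
  \<open>{1..n}\<close> need not leave an initial interval.\<close>

definition signed_sum :: "'a set \<Rightarrow> int" where
  "signed_sum S = (\<Sum>\<pi>\<in>involutions_on S. (- 1) ^ card (two_cycles \<pi>))"

lemma mem_involutions_on_iff:
  "\<pi> \<in> involutions_on S \<longleftrightarrow> (\<forall>x. x \<notin> S \<longrightarrow> \<pi> x = x) \<and> (\<forall>x. \<pi> (\<pi> x) = x)"
proof
  assume "\<pi> \<in> involutions_on S"
  then show "(\<forall>x. x \<notin> S \<longrightarrow> \<pi> x = x) \<and> (\<forall>x. \<pi> (\<pi> x) = x)"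
    by (auto simp: involutions_on_def permutes_not_in fun_eq_iff)
next
  assume inv: "(\<forall>x. x \<notin> S \<longrightarrow> \<pi> x = x) \<and> (\<forall>x. \<pi> (\<pi> x) = x)"
  then have "\<exists>!x. \<pi> x = y" for y by (intro ex1I[of _ "\<pi> y"]) auto
  with inv show "\<pi> \<in> involutions_on S"
    by (auto simp: involutions_on_def permutes_def)
qed

lemma finite_involutions_on: "finite S \<Longrightarrow> finite (involutions_on S)"
  unfolding involutions_on_def by (rule finite_subset[OF _ finite_permutations[of S]]) auto

lemma finite_two_cycles:
  assumes "finite S" "\<pi> \<in> involutions_on S"
  shows "finite (two_cycles \<pi>)"
proof (rule finite_subset)
  show "two_cycles \<pi> \<subseteq> (\<lambda>i. {i, \<pi> i}) ` S"
    using assms(2) by (auto simp: two_cycles_def mem_involutions_on_iff)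
qed (use assms(1) in simp)

lemma orbit_involution:
  assumes "\<pi> \<circ> \<pi> = id"
  shows "orbit \<pi> i = {i, \<pi> i}"
proof
  have inv: "\<pi> (\<pi> x) = x" for x using assms by (simp add: fun_eq_iff)
  show "orbit \<pi> i \<subseteq> {i, \<pi> i}"
  proof
    fix y assume "y \<in> orbit \<pi> i"
    then show "y \<in> {i, \<pi> i}" by induction (auto simp: inv)
  qed
  show "{i, \<pi> i} \<subseteq> orbit \<pi> i"
    using orbit.base[of \<pi> i] orbit.step[of "\<pi> i" \<pi> i] by (simp add: inv)
qed

lemma num_two_cycles_eq:
  assumes "\<pi> \<in> involutions n"
  shows "num_two_cycles \<pi> n = card (two_cycles \<pi>)"
proof -
  have p: "\<pi> permutes {1..n}" and inv: "\<pi> \<circ> \<pi> = id"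
    using assms by (simp_all add: involutions_def)
  note orb = orbit_involution[OF inv]
  have two: "card {i, \<pi> i} = 2 \<longleftrightarrow> \<pi> i \<noteq> i" for i
    by (auto simp: card_insert_if)
  \<comment> \<open>Points moved by \<open>\<pi>\<close> lie in \<open>{1..n}\<close>, so letting
    \<open>i\<close> range over everything adds no pair.\<close>
  have "{C. (\<exists>i\<in>{1..n}. C = orbit \<pi> i) \<and> card C = 2} = two_cycles \<pi>"
    unfolding orb two_cycles_def using two permutes_not_in[OF p] by blast
  then show ?thesis by (simp add: num_two_cycles_def)
qed

lemma t_signed_eq_signed_sum: "t_signed n = signed_sum {1..n}"
  unfolding t_signed_def signed_sum_def
  by (rule sum.cong) (auto simp: involutions_def involutions_on_def num_two_cycles_eq)

section \<open>Recurrence from the image of one added point\<close>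

lemma signed_sum_empty: "signed_sum ({} :: 'a set) = 1"
proof -
  have "involutions_on ({} :: 'a set) = {id}" by (auto simp: involutions_on_def)
  moreover have "two_cycles (id :: 'a \<Rightarrow> 'a) = {}" by (simp add: two_cycles_def)
  ultimately show ?thesis by (simp add: signed_sum_def)
qed

lemma two_cycles_add_transposition:
  assumes "x \<noteq> j" "\<pi> x = x" "\<pi> j = j" "\<And>i. \<pi> (\<pi> i) = i"
  shows "two_cycles (\<pi>(x := j, j := x)) = insert {x, j} (two_cycles \<pi>)"
    and "{x, j} \<notin> two_cycles \<pi>"
proof -
  let ?p = "\<pi>(x := j, j := x)"
  show "{x, j} \<notin> two_cycles \<pi>"
    using assms(2,3) by (auto simp: two_cycles_def doubleton_eq_iff)
  show "two_cycles ?p = insert {x, j} (two_cycles \<pi>)"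
  proof
    show "two_cycles ?p \<subseteq> insert {x, j} (two_cycles \<pi>)"
      by (auto simp: two_cycles_def split: if_splits)
    have "{x, j} \<in> two_cycles ?p"
      unfolding two_cycles_def using assms(1) by (intro CollectI exI[of _ x]) auto
    moreover have "{i, \<pi> i} \<in> two_cycles ?p" if "\<pi> i \<noteq> i" for i
      unfolding two_cycles_def using that assms(2,3) by (intro CollectI exI[of _ i]) auto
    ultimately show "insert {x, j} (two_cycles \<pi>) \<subseteq> two_cycles ?p"
      unfolding two_cycles_def[of \<pi>] by blast
  qed
qed

text \<open>Removing the 2-cycle \<open>{x, j}\<close> is a bijection onto the involutions of
  \<open>S - {j}\<close>; it lowers the number of 2-cycles by one, which gives the minus
  sign.\<close>

lemma sum_involutions_swapping:
  assumes "finite S" "x \<notin> S" "j \<in> S"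
  shows "(\<Sum>\<pi> | \<pi> \<in> involutions_on (insert x S) \<and> \<pi> x = j. (- 1) ^ card (two_cycles \<pi>))
    = - signed_sum (S - {j})"
proof -
  have ne: "x \<noteq> j" using assms by auto
  have "(\<Sum>\<pi> | \<pi> \<in> involutions_on (insert x S) \<and> \<pi> x = j. (- 1) ^ card (two_cycles \<pi>))
    = (\<Sum>\<pi>\<in>involutions_on (S - {j}). - ((- 1 :: int) ^ card (two_cycles \<pi>)))"
  proof (rule sum.reindex_bij_witness[where i = "\<lambda>q. q(x := j, j := x)" and j = "\<lambda>p. p(x := x, j := j)"])
    fix p assume p: "p \<in> {\<pi> \<in> involutions_on (insert x S). \<pi> x = j}"
    then have px: "p x = j" and pp: "\<And>i. p (p i) = i" and out: "\<And>i. i \<notin> insert x S \<Longrightarrow> p i = i"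
      by (auto simp: mem_involutions_on_iff)
    have pj: "p j = x" using px pp by metis
    show eq: "(p(x := x, j := j))(x := j, j := x) = p" using px pj by auto
    \<comment> \<open>As \<open>p\<close> is its own inverse, only \<open>x\<close> and
      \<open>j\<close> map into \<open>{x, j}\<close>; hence the update at these two points does not
      spoil the involution elsewhere.\<close>
    have other: "p i \<noteq> x" "p i \<noteq> j" if "i \<noteq> x" "i \<noteq> j" for i
      using that px pj pp by metis+
    show q: "p(x := x, j := j) \<in> involutions_on (S - {j})"
      unfolding mem_involutions_on_iff using ne pp out other by auto
    have fin: "finite (two_cycles (p(x := x, j := j)))"
      using finite_two_cycles[OF _ q] assms(1) by simp
    have *: "two_cycles p = insert {x, j} (two_cycles (p(x := x, j := j)))"
      "{x, j} \<notin> two_cycles (p(x := x, j := j))"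
      using two_cycles_add_transposition[of x j "p(x := x, j := j)"] ne q eq
      by (auto simp: mem_involutions_on_iff)
    show "- ((- 1 :: int) ^ card (two_cycles (p(x := x, j := j)))) = (- 1) ^ card (two_cycles p)"
      unfolding *(1) using fin *(2) by simp
  next
    fix q assume q: "q \<in> involutions_on (S - {j})"
    then have qx: "q x = x" and qj: "q j = j" and qq: "\<And>i. q (q i) = i"
        and out: "\<And>i. i \<notin> S - {j} \<Longrightarrow> q i = i"
      using assms by (auto simp: mem_involutions_on_iff)
    show "(q(x := j, j := x))(x := x, j := j) = q" using qx qj by auto
    have other: "q i \<noteq> x" "q i \<noteq> j" if "i \<noteq> x" "i \<noteq> j" for i
      using that qx qj qq by metis+
    show "q(x := j, j := x) \<in> {\<pi> \<in> involutions_on (insert x S). \<pi> x = j}"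
      using ne qq out other assms(3) by (auto simp: mem_involutions_on_iff)
  qed
  then show ?thesis by (simp add: signed_sum_def sum_negf)
qed

lemma signed_sum_insert:
  assumes "finite S" "x \<notin> S"
  shows "signed_sum (insert x S) = signed_sum S - (\<Sum>j\<in>S. signed_sum (S - {j}))"
proof -
  let ?I = "involutions_on (insert x S)" and ?f = "\<lambda>\<pi>. (- 1 :: int) ^ card (two_cycles \<pi>)"
  have "(\<lambda>\<pi>. \<pi> x) ` ?I \<subseteq> insert x S"
    by (auto simp: involutions_on_def dest: permutes_in_image)
  \<comment> \<open>Split into the fibres of \<open>\<pi> \<mapsto> \<pi> x\<close>; the fibre over
    \<open>x\<close> itself is \<open>involutions_on S\<close>.\<close>
  then have "signed_sum (insert x S) = (\<Sum>j\<in>insert x S. \<Sum>\<pi> | \<pi> \<in> ?I \<and> \<pi> x = j. ?f \<pi>)"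
    unfolding signed_sum_def using assms(1)
    by (intro sum.group[symmetric] finite_involutions_on) auto
  also have "\<dots> = (\<Sum>\<pi> | \<pi> \<in> ?I \<and> \<pi> x = x. ?f \<pi>) + (\<Sum>j\<in>S. - signed_sum (S - {j}))"
    using assms by (simp add: sum_involutions_swapping)
  also have "{\<pi> \<in> ?I. \<pi> x = x} = involutions_on S"
    using assms(2) by (auto simp: mem_involutions_on_iff)
  finally show ?thesis by (simp add: signed_sum_def sum_negf)
qed

text \<open>Strong induction through \<open>signed_sum_insert\<close>, which reduces to sets with
  one and two points fewer; no conjugation of involutions by a bijection is required.\<close>

lemma signed_sum_cong_card:
  assumes "finite S" "finite S'" "card S = card S'"
  shows "signed_sum S = signed_sum S'"
  using assms
proof (induction "card S" arbitrary: S S' rule: less_induct)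
  case less
  show ?case
  proof (cases "S = {}")
    case True
    then show ?thesis using less.prems by (simp add: signed_sum_empty)
  next
    case False
    then have ne': "S' \<noteq> {}" using less.prems by auto
    obtain x U where S: "S = insert x U" "x \<notin> U" using False by (metis Set.set_insert ex_in_conv)
    obtain y V where S': "S' = insert y V" "y \<notin> V" using ne' by (metis Set.set_insert ex_in_conv)
    have fin: "finite U" "finite V" and card: "card U = card V" and lt: "card U < card S"
      using less.prems S S' by auto
    have UV: "signed_sum U = signed_sum V"
      using less.hyps[OF lt fin card] .
    have minus: "signed_sum (U - {i}) = signed_sum (V - {j})" if "i \<in> U" "j \<in> V" for i j
      by (rule less.hyps) (use that fin card lt in \<open>auto simp: card_Diff_singleton\<close>)
    have "(\<Sum>i\<in>U. signed_sum (U - {i})) = (\<Sum>j\<in>V. signed_sum (V - {j}))"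
    proof -
      \<comment> \<open>All summands on both sides are equal, so any bijection can match
        them.\<close>
      obtain h where h: "bij_betw h U V"
        using finite_same_card_bij[OF fin card] by blast
      have "(\<Sum>i\<in>U. signed_sum (U - {i})) = (\<Sum>i\<in>U. signed_sum (V - {h i}))"
        using minus bij_betwE[OF h] by (intro sum.cong) auto
      also have "\<dots> = (\<Sum>j\<in>V. signed_sum (V - {j}))"
        by (rule sum.reindex_bij_betw[OF h])
      finally show ?thesis .
    qed
    then show ?thesis
      using UV S S' fin by (simp add: signed_sum_insert)
  qed
qed

section \<open>The recurrence for \<open>t_signed\<close> and its four-step form\<close>

lemma t_signed_eq_card: "finite S \<Longrightarrow> t_signed (card S) = signed_sum S"
  unfolding t_signed_eq_signed_sum by (rule signed_sum_cong_card) auto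

lemma t_signed_0: "t_signed 0 = 1"
  by (simp add: t_signed_eq_signed_sum signed_sum_empty)

text \<open>At \<open>n = 0\<close> the truncated \<open>n - 1\<close> is harmless, its term having
  the factor 0.\<close>

lemma t_signed_Suc:
  "t_signed (Suc n) = t_signed n - int n * t_signed (n - 1)"
proof -
  have "t_signed (Suc n) = signed_sum (insert (Suc n) {1..n})"
    by (simp add: t_signed_eq_signed_sum atLeastAtMostSuc_conv)
  also have "\<dots> = signed_sum {1..n} - (\<Sum>j\<in>{1..n}. signed_sum ({1..n} - {j}))"
    by (rule signed_sum_insert) auto
  also have "(\<Sum>j\<in>{1..n}. signed_sum ({1..n} - {j})) = (\<Sum>j\<in>{1..n}. t_signed (n - 1))"
    by (rule sum.cong) (auto simp: t_signed_eq_card[symmetric] card_Diff_singleton)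
  finally show ?thesis by (simp add: t_signed_eq_signed_sum)
qed

lemma t_signed_block:
  defines "a k \<equiv> t_signed (4 * k)" and "b k \<equiv> t_signed (4 * k + 1)"
  shows "t_signed (4 * k + 2) = b k - (4 * int k + 1) * a k"
    and "t_signed (4 * k + 3) = - (4 * int k + 1) * (a k + b k)"
    and "a (Suc k) = (4 * int k + 1) * (4 * int k + 2) * a k - (8 * int k + 4) * b k"
    and "b (Suc k) = (4 * int k + 1) * (8 * int k + 6) * a k + (16 * (int k)^2 + 12 * int k) * b k"
proof -
  have rec: "t_signed (m + 2) = t_signed (m + 1) - (int m + 1) * t_signed m" for m
    using t_signed_Suc[of "Suc m"] by (simp add: algebra_simps)
  have r2: "t_signed (4 * k + 2) = b k - (4 * int k + 1) * a k"
    using rec[of "4 * k"] by (simp add: a_def b_def)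
  have r3: "t_signed (4 * k + 3) = t_signed (4 * k + 2) - (4 * int k + 2) * b k"
    using rec[of "4 * k + 1"] by (simp add: b_def eval_nat_numeral)
  have r4: "a (Suc k) = t_signed (4 * k + 3) - (4 * int k + 3) * t_signed (4 * k + 2)"
    using rec[of "4 * k + 2"] by (simp add: a_def eval_nat_numeral)
  have r5: "b (Suc k) = a (Suc k) - (4 * int k + 4) * t_signed (4 * k + 3)"
    using rec[of "4 * k + 3"] by (simp add: a_def b_def eval_nat_numeral)
  show "t_signed (4 * k + 2) = b k - (4 * int k + 1) * a k" by (fact r2)
  show s3: "t_signed (4 * k + 3) = - (4 * int k + 1) * (a k + b k)"
    unfolding r3 r2 by algebra
  show s4: "a (Suc k) = (4 * int k + 1) * (4 * int k + 2) * a k - (8 * int k + 4) * b k"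
    unfolding r4 s3 r2 by algebra
  show "b (Suc k) = (4 * int k + 1) * (8 * int k + 6) * a k + (16 * (int k)^2 + 12 * int k) * b k"
    unfolding r5 s4 s3 by algebra
qed

text \<open>Parities of the cofactors alone would not settle \<open>t_signed (4 * k + 2)\<close>,
  which is a difference of two odd multiples of \<open>2 ^ k\<close>. The form therefore records
  that difference exactly, as \<open>2 ^ k * (8 * int k * c)\<close>.\<close>

lemma t_signed_block_form:
  "\<exists>a c. odd a \<and> odd c \<and> t_signed (4 * k) = 2 ^ k * a \<and>
    t_signed (4 * k + 1) = 2 ^ k * (8 * int k * c + (4 * int k + 1) * a)"
proof (induction k)
  case 0
  have "t_signed 1 = 1" using t_signed_Suc[of 0] t_signed_0 by simp
  \<comment> \<open>Both witnesses are 1; any odd \<open>c\<close> would do, as its coefficient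
    vanishes at \<open>k = 0\<close>.\<close>
  then show ?case by (intro exI[of _ 1]) (simp add: t_signed_0)
next
  case (Suc k)
  then obtain a c where "odd a" "odd c" and a: "t_signed (4 * k) = 2 ^ k * a"
    and b: "t_signed (4 * k + 1) = 2 ^ k * (8 * int k * c + (4 * int k + 1) * a)" by blast
  \<comment> \<open>Substituting the hypothesis into the four-step recurrence and dividing by
    \<open>2 ^ Suc k\<close> gives \<open>a'\<close>. Then \<open>c'\<close> solves the required
    form of \<open>t_signed (4 * Suc k + 1)\<close>: the coefficient of \<open>c\<close> there
    contains \<open>24k^2 + 34k + 10 = 2(k + 1)(12k + 5)\<close>, so the division by
    \<open>8(k + 1)\<close> is exact. Each of \<open>a'\<close> and \<open>c'\<close> is an odd
    multiple of \<open>a\<close> plus an even number.\<close>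
  define a' where "a' = - (4 * int k + 1) * (2 * int k + 1) * a - (4 * int k + 2) * (8 * int k * c)"
  define c' where "c' = (4 * int k + 1) * (2 * int k + 1) * a + 2 * (12 * int k + 5) * int k * c"
  have "odd a'" "odd c'" using \<open>odd a\<close> by (simp_all add: a'_def c'_def)
  moreover have "t_signed (4 * Suc k) = 2 ^ Suc k * a'"
    unfolding t_signed_block(3) a b a'_def power_Suc by algebra
  moreover have "t_signed (4 * Suc k + 1)
      = 2 ^ Suc k * (8 * int (Suc k) * c' + (4 * int (Suc k) + 1) * a')"
    unfolding t_signed_block(4) a b a'_def c'_def power_Suc of_nat_Suc by algebra
  ultimately show ?case by blast
qed

section \<open>Valuations in the four residue classes\<close>

lemma ord2_power_mult:
  "ord2 (2 ^ e * m) = enat e + ord2 m"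
  by (simp add: ord2_def prime_elem_multiplicity_mult_distrib)

lemma ord2_mult_odd:
  assumes "odd u"
  shows "ord2 (m * u) = ord2 m"
  using assms not_dvd_imp_multiplicity_0[OF assms]
  by (cases "m = 0") (auto simp: ord2_def prime_elem_multiplicity_mult_distrib)

lemma ord2_odd: "odd u \<Longrightarrow> ord2 u = 0"
  by (auto simp: ord2_def not_dvd_imp_multiplicity_0 zero_enat_def)

theorem theorem5p2:
  fixes n k r :: nat
  assumes "n = 4 * k + r" and "r < 4"
  shows "ord2 (t_signed n) =
    (if r \<noteq> 2 then enat (k + r div 2) else enat (k + 3) + ord2 (int k))"
proof -
  obtain a c where "odd a" "odd c" and a: "t_signed (4 * k) = 2 ^ k * a"
    and b: "t_signed (4 * k + 1) = 2 ^ k * (8 * int k * c + (4 * int k + 1) * a)"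
    using t_signed_block_form by blast
  \<comment> \<open>The multiples of \<open>a\<close> cancel, leaving only the \<open>c\<close>
    term.\<close>
  have t2: "t_signed (4 * k + 2) = 2 ^ (k + 3) * (int k * c)"
    unfolding t_signed_block(1) a b by (simp add: power_add algebra_simps)
  \<comment> \<open>The coefficient of \<open>a\<close> in the sum of the two values is
    \<open>4k + 2\<close>, which supplies the extra factor 2.\<close>
  have t3: "t_signed (4 * k + 3)
      = 2 ^ (k + 1) * (- (4 * int k + 1) * (4 * int k * c + (2 * int k + 1) * a))"
    unfolding t_signed_block(2) a b by (simp add: power_add algebra_simps)
  consider "r = 0" | "r = 1" | "r = 2" | "r = 3" using assms(2) by linarith
  then show ?thesis
  proof cases
    case 1
    then show ?thesis using assms(1) a \<open>odd a\<close> by (simp add: ord2_power_mult ord2_odd)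
  next
    case 2
    have "odd (8 * int k * c + (4 * int k + 1) * a)" using \<open>odd a\<close> by simp
    then show ?thesis using 2 assms(1) b by (simp add: ord2_power_mult ord2_odd)
  next
    case 3
    \<comment> \<open>This includes \<open>k = 0\<close>, where \<open>t_signed 2 = 0\<close> and
      both sides are infinite.\<close>
    have "ord2 (t_signed n) = enat (k + 3) + ord2 (int k)"
      unfolding assms(1) 3 t2 ord2_power_mult ord2_mult_odd[OF \<open>odd c\<close>] ..
    then show ?thesis using 3 by simp
  next
    case 4
    have "odd (- (4 * int k + 1) * (4 * int k * c + (2 * int k + 1) * a))" using \<open>odd a\<close> by simp
    then have "ord2 (t_signed n) = enat (k + 1)"
      unfolding assms(1) 4 t3 ord2_power_mult by (simp add: ord2_odd)
    then show ?thesis using 4 by simp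
  qed
qed

end
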